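(* Let $0<\alpha<2$, let $\tau_n=\tau^\alpha_n$ be the discrete subordinator, and let $F_n(t)=\mathbb{P}(\tau_n\le t)$. Whenever $n t^{-\alpha/2}$ tends to zero ($n\in\mathbb{N}$, $t>0$), $$1-F_n(t)\sim\frac{n\,t^{-\alpha/2}}{\Gamma(1-\alpha/2)}.$$
   Context: $\mathbb{N}=\{1,2,\dots\}$. The discrete subordinator is $\tau^\alpha_n=R_1+\dots+R_n$ with $R_i$ i.i.d. positive integer valued random variables, whose law is determined by $\mathbb{E}(e^{-\lambda\tau^\alpha_n})=(1-(1-e^{-\lambda})^{\alpha/2})^n$ for $\lambda\ge0$. $f\sim g$ in the stated regime means that $f/g\to1$ along every sequence $(n_k,t_k)$ with $n_kt_k^{-\alpha/2}\to0$. *)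

theory Defs
  imports "HOL-Probability.Probability"
begin

definition partial_sum :: "(nat \<Rightarrow> 'a \<Rightarrow> nat) \<Rightarrow> nat \<Rightarrow> 'a \<Rightarrow> nat"
  where "partial_sum R n \<omega> = (\<Sum>i=1..n. R i \<omega>)"

text \<open>
  The increments are indexed by the positive integers; \<^term>\<open>R 0\<close> is irrelevant.
  Note that \<^term>\<open>0 powr x = (0::real)\<close>, so the transform identity reads 1 = 1 at 0.
\<close>

locale discrete_subordinator = prob_space M
  for M :: "'a measure" and \<alpha> :: real and R :: "nat \<Rightarrow> 'a \<Rightarrow> nat" +
  assumes indep: "indep_vars (\<lambda>_. count_space UNIV) R {1..}"
    and identically_distributed: "\<And>i. i \<ge> 1 \<Longrightarrow>
      distr M (count_space UNIV) (R i) = distr M (count_space UNIV) (R 1)"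
    and positive: "\<And>i \<omega>. i \<ge> 1 \<Longrightarrow> \<omega> \<in> space M \<Longrightarrow> R i \<omega> \<ge> 1"
    and laplace_transform: "\<And>n s. n \<ge> 1 \<Longrightarrow> s \<ge> 0 \<Longrightarrow>
      expectation (\<lambda>\<omega>. exp (- s * real (partial_sum R n \<omega>))) =
        (1 - (1 - exp (- s)) powr (\<alpha> / 2)) ^ n"

definition subordinator_cdf ::
    "'a measure \<Rightarrow> (nat \<Rightarrow> 'a \<Rightarrow> nat) \<Rightarrow> nat \<Rightarrow> real \<Rightarrow> real"
  where "subordinator_cdf M R n t = measure M {\<omega> \<in> space M. real (partial_sum R n \<omega>) \<le> t}"

end

theory Submission
  imports Defs "HOL-Complex_Analysis.Cauchy_Integral_Formula"
    "HOL-Real_Asymp.Real_Asymp"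
begin

text \<open>
  With \<open>\<beta> = \<alpha> / 2\<close>, comparing power series coefficients shows that the increments have the Sibuya
  tail \<open>P(R > m) = (-1)\<^sup>m (\<beta> - 1 gchoose m)\<close>, so \<open>P(R > x) x\<^sup>\<beta> \<rightarrow> 1 / \<Gamma>(1 - \<beta>)\<close>.
  The rest is the principle of one big jump, uniformly in \<open>n\<close>. From below,
  \<open>P(\<tau>\<^sub>n > t) \<ge> 1 - (1 - P(R > t))\<^sup>n\<close>. From above, if \<open>\<tau>\<^sub>n > t\<close>, then some increment exceeds
  \<open>(1 - \<epsilon>) t\<close>, or two increments exceed \<open>\<eta> t\<close>, or the increments that are at most \<open>\<eta> t\<close> add up
  to more than \<open>\<epsilon> t\<close>. Relative to \<open>n t\<^sup>-\<^sup>\<beta>\<close> the second probability vanishes, and by Markov's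
  inequality the third is at most \<open>2 \<eta>\<^bsup>1 - \<beta>\<^esup> / \<epsilon>\<close>.
\<close>

section \<open>Analytic preliminaries: uniqueness of power series coefficients and a smooth
  truncation\<close>

lemma powser_eq_imp_coeff_eq:
  fixes a b :: "nat \<Rightarrow> real" and f :: "real \<Rightarrow> real"
  assumes a: "\<And>x. 0 < x \<Longrightarrow> x < 1 \<Longrightarrow> (\<lambda>n. a n * x ^ n) sums f x"
    and b: "\<And>x. 0 < x \<Longrightarrow> x < 1 \<Longrightarrow> (\<lambda>n. b n * x ^ n) sums f x"
    and "a 0 = b 0"
  shows "a m = b m"
proof (rule ccontr)
  assume "a m \<noteq> b m"
  define c where "c n = a n - b n" for n
  have m: "c m \<noteq> 0" "m > 0"
    using \<open>a m \<noteq> b m\<close> \<open>a 0 = b 0\<close> by (auto simp: c_def intro: gr0I)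
  have c0: "(\<lambda>n. c n * x ^ n) sums 0" if "0 < x" "x < 1" for x
    using sums_diff[OF a[OF that] b[OF that]] by (simp add: c_def algebra_simps)
  \<comment> \<open>Convergence at 1/2 extends to the whole ball of that radius, negative
    \<open>x\<close> included, as the theorem on isolated zeros demands.\<close>
  have "summable (\<lambda>n. c n * (1/2) ^ n)"
    using c0[of "1/2"] by (auto simp: sums_iff)
  then have "(\<lambda>n. c n * (x - 0) ^ n) sums (\<Sum>n. c n * x ^ n)" if "norm (x - 0) < 1/2" for x
    using that by (auto intro!: summable_sums elim!: powser_inside)
  \<comment> \<open>Zeros of a nontrivial power series are isolated. Equal constant terms make 0 a
    zero of the difference, which however also vanishes at every point of (0, 1), so at
    \<open>min s (1/2)\<close>.\<close>
  then obtain s where s: "s > 0" "\<And>z. z \<in> cball 0 s - {0} \<Longrightarrow> (\<Sum>n. c n * z ^ n) \<noteq> 0"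
    using powser_0_nonzero[of "1/2" 0 c "\<lambda>x. \<Sum>n. c n * x ^ n" m] m \<open>a 0 = b 0\<close>
    by (auto simp: c_def)
  have "(\<Sum>n. c n * (min s (1/2)) ^ n) = 0"
    using c0[of "min s (1/2)"] s(1) by (auto simp: sums_iff)
  then show False
    using s(1) s(2)[of "min s (1/2)"] by auto
qed

text \<open>With \<open>v = y / x\<close> in [0, 1], \<open>exp (- v)\<close> is at most
  \<open>1 / (1 + v)\<close> and hence at most \<open>1 - v / 2\<close>, whence the factor 2. The
  right-hand side replaces truncation at \<open>x\<close> by a function whose mean the Laplace
  transform gives directly.\<close>

lemma le_truncation_bound:
  fixes x y :: real
  assumes "0 \<le> y" "y \<le> x" "0 < x"
  shows "y \<le> 2 * x * (1 - exp (- y / x))"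
proof -
  define v where "v = y / x"
  have v: "0 \<le> v" "v \<le> 1"
    using assms by (auto simp: v_def)
  have "exp (- v) \<le> 1 / (1 + v)"
    using exp_ge_add_one_self[of v] v by (simp add: exp_minus inverse_eq_divide frac_le)
  also have "\<dots> \<le> 1 - v / 2"
    using v mult_left_mono[of v 1 v] by (simp add: field_simps)
  finally have "x * v \<le> x * (2 * (1 - exp (- v)))"
    using assms by (intro mult_left_mono) auto
  then show ?thesis
    using assms by (simp add: v_def algebra_simps)
qed

context discrete_subordinator
begin

section \<open>The exact law of a single increment\<close>

definition tail :: "real \<Rightarrow> real"
  where "tail x = prob {\<omega> \<in> space M. x < real (R 1 \<omega>)}"

lemma measurable_increment [measurable]: "i \<ge> 1 \<Longrightarrow> R i \<in> measurable M (count_space UNIV)"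
  using indep by (auto simp: indep_vars_def)

lemma measurable_partial_sum [measurable]: "partial_sum R n \<in> measurable M (count_space UNIV)"
  unfolding partial_sum_def[abs_def] by measurable

lemma prob_increment:
  assumes "i \<ge> 1"
  shows "prob {\<omega> \<in> space M. P (R i \<omega>)} = prob {\<omega> \<in> space M. P (R 1 \<omega>)}"
proof -
  have "measure (distr M (count_space UNIV) (R j)) (Collect P) = prob {\<omega> \<in> space M. P (R j \<omega>)}"
    if "j \<ge> 1" for j
    using that by (subst measure_distr) (auto intro!: arg_cong[where f = prob])
  then show ?thesis
    using identically_distributed[OF assms] assms by (metis order_refl)
qed

lemma expectation_increment:
  fixes f :: "nat \<Rightarrow> real"
  assumes "i \<ge> 1"
  shows "expectation (\<lambda>\<omega>. f (R i \<omega>)) = expectation (\<lambda>\<omega>. f (R 1 \<omega>))"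
proof -
  have "integral\<^sup>L (distr M (count_space UNIV) (R j)) f = expectation (\<lambda>\<omega>. f (R j \<omega>))"
    if "j \<ge> 1" for j
    using that by (subst integral_distr) auto
  then show ?thesis
    using identically_distributed[OF assms] assms by (metis order_refl)
qed

lemma expectation_exp_increment:
  assumes "i \<ge> 1" "s \<ge> 0"
  shows "expectation (\<lambda>\<omega>. exp (- s * real (R i \<omega>))) = 1 - (1 - exp (- s)) powr (\<alpha> / 2)"
  using expectation_increment[OF assms(1), of "\<lambda>r. exp (- s * real r)"]
    laplace_transform[of 1 s] assms(2)
  by (simp add: partial_sum_def)

text \<open>The Laplace transform at \<open>- ln x\<close> is the expectation of
  \<open>x ^ R 1\<close>. Splitting by the value of \<open>R 1\<close>, sum and expectation may be
  exchanged because a geometric series dominates.\<close>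

lemma generating_function_sums:
  assumes "0 < x" "x < 1"
  shows "(\<lambda>k. prob {\<omega> \<in> space M. R 1 \<omega> = k} * x ^ k) sums (1 - (1 - x) powr (\<alpha> / 2))"
proof -
  define f where "f k \<omega> = indicator {\<omega> \<in> space M. R 1 \<omega> = k} \<omega> * x ^ k" for k \<omega>
  have int: "integral\<^sup>L M (f k) = prob {\<omega> \<in> space M. R 1 \<omega> = k} * x ^ k" for k
    unfolding f_def by (simp add: Int_def conj_commute cong: conj_cong)
  have f_sums: "(\<lambda>k. f k \<omega>) sums x ^ R 1 \<omega>" if "\<omega> \<in> space M" for \<omega>
    using sums_finite[of "{R 1 \<omega>}" "\<lambda>k. f k \<omega>"] that by (auto simp: f_def)
  have nonneg: "norm (f k \<omega>) = f k \<omega>" for k \<omega>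
    using assms by (simp add: f_def)
  have "(\<lambda>k. integral\<^sup>L M (f k)) sums expectation (\<lambda>\<omega>. \<Sum>k. f k \<omega>)"
  proof (rule sums_integral)
    show "integrable M (f k)" for k
      unfolding f_def by (auto intro!: integrable_mult_left integrable_real_indicator
        simp: emeasure_eq_measure)
    show "AE \<omega> in M. summable (\<lambda>k. norm (f k \<omega>))"
      unfolding nonneg using f_sums by (auto simp: sums_iff)
    show "summable (\<lambda>k. \<integral>\<omega>. norm (f k \<omega>) \<partial>M)"
      unfolding nonneg int
    proof (rule summable_comparison_test')
      show "summable (\<lambda>k. x ^ k)"
        using assms by (simp add: summable_geometric)
      show "norm (prob {\<omega> \<in> space M. R 1 \<omega> = k} * x ^ k) \<le> x ^ k" for k
        using assms by (simp add: abs_mult mult_left_le_one_le)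
    qed
  qed
  also have "expectation (\<lambda>\<omega>. \<Sum>k. f k \<omega>) = expectation (\<lambda>\<omega>. exp (- (- ln x) * real (R 1 \<omega>)))"
  proof (rule Bochner_Integration.integral_cong)
    fix \<omega> assume "\<omega> \<in> space M"
    then show "(\<Sum>k. f k \<omega>) = exp (- (- ln x) * real (R 1 \<omega>))"
      using f_sums[of \<omega>] assms exp_of_nat_mult[of "R 1 \<omega>" "ln x"]
      by (simp add: sums_iff mult.commute)
  qed simp
  also have "\<dots> = 1 - (1 - x) powr (\<alpha> / 2)"
    using assms by (subst expectation_exp_increment) (auto simp: exp_minus)
  finally show ?thesis
    unfolding int .
qed

text \<open>Both sides are coefficients of the generating function, the right-hand one by the
  binomial series at \<open>- x\<close>. The leading 1 cancels the binomial term at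
  \<open>k = 0\<close>; the constant coefficient on the left is 0 by positivity of the
  increments.\<close>

lemma prob_increment_eq:
  "prob {\<omega> \<in> space M. R 1 \<omega> = k} =
    (if k = 0 then 0 else - ((\<alpha> / 2 gchoose k) * (-1) ^ k))" (is "?p k = ?q k")
proof (rule powser_eq_imp_coeff_eq)
  fix x :: real assume x: "0 < x" "x < 1"
  show "(\<lambda>n. ?p n * x ^ n) sums (1 - (1 - x) powr (\<alpha> / 2))"
    using generating_function_sums[OF x] .
  have "(\<lambda>n. (\<alpha> / 2 gchoose n) * (- x) ^ n) sums (1 - x) powr (\<alpha> / 2)"
    using gen_binomial_real[of "- x" "\<alpha> / 2"] x by simp
  moreover have "(\<lambda>n. if n = 0 then 1 else (0 :: real)) sums 1"
    using sums_single[of 0 "\<lambda>_. 1 :: real"] by simp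
  ultimately have "(\<lambda>n. (if n = 0 then 1 else 0) - (\<alpha> / 2 gchoose n) * (- x) ^ n)
      sums (1 - (1 - x) powr (\<alpha> / 2))"
    by (rule sums_diff[rotated])
  also have "(\<lambda>n. (if n = 0 then 1 else 0) - (\<alpha> / 2 gchoose n) * (- x) ^ n) =
      (\<lambda>n. ?q n * x ^ n)"
    by (auto simp: fun_eq_iff power_minus[of x])
  finally show "(\<lambda>n. ?q n * x ^ n) sums (1 - (1 - x) powr (\<alpha> / 2))" .
next
  have "{\<omega> \<in> space M. R 1 \<omega> = 0} = {}"
    using positive[of 1] by force
  then show "?p 0 = ?q 0"
    by (simp only: measure_empty if_True refl)
qed

text \<open>By Pascal's rule the alternating partial sums of the binomial coefficients of
  \<open>\<alpha> / 2\<close> telescope to a single coefficient of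
  \<open>\<alpha> / 2 - 1\<close>.\<close>

lemma tail_nat: "tail (real m) = (-1) ^ m * (\<alpha> / 2 - 1 gchoose m)"
proof -
  have "prob {\<omega> \<in> space M. \<not> R 1 \<omega> > m} = (\<Sum>k\<le>m. prob {\<omega> \<in> space M. R 1 \<omega> = k})"
    by (subst finite_measure_finite_Union[symmetric])
      (auto simp: disjoint_family_on_def intro!: arg_cong[where f = prob])
  \<comment> \<open>As the binomial coefficient at 0 equals 1, the exceptional case
    \<open>k = 0\<close> fits the general formula once 1 is added there.\<close>
  also have "\<dots> = (\<Sum>k\<le>m. (if k = 0 then 1 else 0) - (\<alpha> / 2 gchoose k) * (-1) ^ k)"
    unfolding prob_increment_eq by (intro sum.cong) auto
  also have "\<dots> = 1 - (-1) ^ m * (\<alpha> / 2 - 1 gchoose m)"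
    unfolding sum_subtractf gbinomial_sum_lower_neg by simp
  finally show ?thesis
    using prob_neg[of "\<lambda>\<omega>. R 1 \<omega> > m"] by (simp add: tail_def)
qed

lemma tail_floor:
  assumes "x \<ge> 0"
  shows "tail x = tail (real (nat \<lfloor>x\<rfloor>))"
proof -
  have "x < real r \<longleftrightarrow> real (nat \<lfloor>x\<rfloor>) < real r" for r
    using assms by (simp only: of_nat_less_iff nat_less_iff zero_le_floor floor_less_iff of_int_of_nat_eq)
  then show ?thesis
    unfolding tail_def by presburger
qed

section \<open>Power-law asymptotics of the tail\<close>

lemma tail_nat_asymptotic:
  "(\<lambda>m. tail (real m) * real m powr (\<alpha> / 2)) \<longlonglongrightarrow> 1 / Gamma (1 - \<alpha> / 2)"
proof (rule Lim_transform_eventually)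
  \<comment> \<open>With \<open>z = \<alpha> / 2 - 1\<close>, the exponential is
    \<open>real m powr (\<alpha> / 2)\<close>, the Gamma argument \<open>- z\<close> is
    \<open>1 - \<alpha> / 2\<close>, and dividing by \<open>(-1) ^ m\<close> supplies the sign in
    \<open>tail_nat\<close>.\<close>
  show "(\<lambda>m. (\<alpha> / 2 - 1 gchoose m) / ((-1) ^ m / exp ((\<alpha> / 2 - 1 + 1) * of_real (ln (real m)))))
      \<longlonglongrightarrow> 1 / Gamma (1 - \<alpha> / 2)"
    using gbinomial_asymptotic[of "\<alpha> / 2 - 1"] by (simp add: inverse_eq_divide)
  show "\<forall>\<^sub>F m in sequentially. (\<alpha> / 2 - 1 gchoose m) /
      ((-1) ^ m / exp ((\<alpha> / 2 - 1 + 1) * of_real (ln (real m)))) =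
      tail (real m) * real m powr (\<alpha> / 2)"
    using eventually_gt_at_top[of 0]
    by eventually_elim (auto simp: tail_nat powr_def minus_one_power_iff)
qed

text \<open>Increments are integers, so \<open>tail\<close> does not change when \<open>x\<close> is
  rounded down. Rounding only affects the power, by a factor that tends to 1.\<close>

lemma tail_asymptotic:
  "((\<lambda>x. tail x * x powr (\<alpha> / 2)) \<longlongrightarrow> 1 / Gamma (1 - \<alpha> / 2)) at_top"
proof (rule Lim_transform_eventually)
  have "filterlim (\<lambda>x::real. nat \<lfloor>x\<rfloor>) sequentially at_top"
    by (intro filterlim_compose[OF filterlim_nat_sequentially] filterlim_floor_sequentially)
  then have "((\<lambda>x::real. tail (real (nat \<lfloor>x\<rfloor>)) * real (nat \<lfloor>x\<rfloor>) powr (\<alpha> / 2))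
      \<longlongrightarrow> 1 / Gamma (1 - \<alpha> / 2)) at_top"
    by (rule filterlim_compose[OF tail_nat_asymptotic])
  moreover have "((\<lambda>x::real. x / real_of_int \<lfloor>x\<rfloor>) \<longlongrightarrow> 1) at_top"
    by real_asymp
  then have "((\<lambda>x::real. (x / real_of_int \<lfloor>x\<rfloor>) powr (\<alpha> / 2)) \<longlongrightarrow> 1 powr (\<alpha> / 2)) at_top"
    by (intro tendsto_intros) auto
  ultimately show "((\<lambda>x::real. tail (real (nat \<lfloor>x\<rfloor>)) * real (nat \<lfloor>x\<rfloor>) powr (\<alpha> / 2)
      * (x / real_of_int \<lfloor>x\<rfloor>) powr (\<alpha> / 2)) \<longlongrightarrow> 1 / Gamma (1 - \<alpha> / 2)) at_top"
    by (auto dest: tendsto_mult)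
  show "\<forall>\<^sub>F x in at_top. tail (real (nat \<lfloor>x\<rfloor>)) * real (nat \<lfloor>x\<rfloor>) powr (\<alpha> / 2)
      * (x / real_of_int \<lfloor>x\<rfloor>) powr (\<alpha> / 2) = tail x * x powr (\<alpha> / 2)"
    using eventually_ge_at_top[of 1]
  proof eventually_elim
    case (elim x)
    then have "\<lfloor>x\<rfloor> \<noteq> 0"
      by linarith
    with elim show ?case
      by (simp add: tail_floor[of x] powr_divide)
  qed
qed

lemma tail_nonneg: "0 \<le> tail x" and tail_le_1: "tail x \<le> 1"
  by (auto simp: tail_def)

lemma tail_increment: "i \<ge> 1 \<Longrightarrow> prob {\<omega> \<in> space M. x < real (R i \<omega>)} = tail x"
  unfolding tail_def by (rule prob_increment)

section \<open>Lower bound: some increment exceeds the level\<close>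

lemma compl_subordinator_cdf:
  "1 - subordinator_cdf M R n t = prob {\<omega> \<in> space M. t < real (partial_sum R n \<omega>)}"
  using prob_neg[of "\<lambda>\<omega>. real (partial_sum R n \<omega>) \<le> t"]
  by (simp add: subordinator_cdf_def not_le)

text \<open>A sum of at most \<open>t\<close> forces every increment to be at most \<open>t\<close>,
  so independence bounds the distribution function by \<open>(1 - tail t) ^ n\<close>. The final
  rational bound depends on \<open>n\<close> and \<open>t\<close> only through
  \<open>real n * tail t\<close>, which makes it uniform in \<open>n\<close>.\<close>

lemma compl_subordinator_cdf_ge:
  assumes "n \<ge> 1"
  shows "real n * tail t / (1 + real n * tail t) \<le> 1 - subordinator_cdf M R n t"
proof -
  have "subordinator_cdf M R n t \<le> prob (\<Inter>i\<in>{1..n}. R i -` {r. real r \<le> t} \<inter> space M)"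
    unfolding subordinator_cdf_def
  proof (rule finite_measure_mono)
    have "real (R i \<omega>) \<le> t" if "i \<in> {1..n}" "real (partial_sum R n \<omega>) \<le> t" for i \<omega>
    proof -
      have "R i \<omega> \<le> partial_sum R n \<omega>"
        unfolding partial_sum_def using that by (intro member_le_sum) auto
      with that show ?thesis
        by linarith
    qed
    then show "{\<omega> \<in> space M. real (partial_sum R n \<omega>) \<le> t}
        \<subseteq> (\<Inter>i\<in>{1..n}. R i -` {r. real r \<le> t} \<inter> space M)"
      by auto
  qed (use assms in \<open>auto intro!: sets.finite_INT\<close>)
  also have "\<dots> = (\<Prod>i\<in>{1..n}. prob (R i -` {r. real r \<le> t} \<inter> space M))"
    using assms by (intro indep_varsD[OF indep]) auto
  also have "\<dots> = (\<Prod>i\<in>{1..n}. 1 - tail t)"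
  proof (rule prod.cong)
    fix i assume "i \<in> {1..n}"
    then show "prob (R i -` {r. real r \<le> t} \<inter> space M) = 1 - tail t"
      using prob_neg[of "\<lambda>\<omega>. t < real (R i \<omega>)"] tail_increment[of i t]
      by (simp add: not_less vimage_def Int_def conj_commute)
  qed simp
  also have "\<dots> = (1 - tail t) ^ n"
    by simp
  also have "\<dots> \<le> exp (- tail t) ^ n"
    using exp_ge_add_one_self[of "- tail t"] tail_le_1[of t] by (intro power_mono) auto
  also have "\<dots> = 1 / exp (real n * tail t)"
    by (simp add: exp_of_nat_mult exp_minus inverse_eq_divide power_one_over)
  also have "\<dots> \<le> 1 / (1 + real n * tail t)"
    using exp_ge_add_one_self[of "real n * tail t"] tail_nonneg[of t]
    by (intro divide_left_mono mult_pos_pos) (auto intro: add_pos_nonneg)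
  finally have "1 - 1 / (1 + real n * tail t) \<le> 1 - subordinator_cdf M R n t"
    by simp
  moreover have "1 + real n * tail t > 0"
    using tail_nonneg[of t] by (auto intro: add_pos_nonneg)
  ultimately show ?thesis
    by (simp add: field_simps)
qed

section \<open>Upper bound: one big jump\<close>

lemma prob_two_increments:
  assumes "i \<ge> 1" "j \<ge> 1" "i \<noteq> j"
  shows "prob {\<omega> \<in> space M. x < real (R i \<omega>) \<and> x < real (R j \<omega>)} = (tail x)\<^sup>2"
proof -
  have eq: "R k -` {r. x < real r} \<inter> space M = {\<omega> \<in> space M. x < real (R k \<omega>)}" for k
    by auto
  have "prob (\<Inter>k\<in>{i, j}. R k -` {r. x < real r} \<inter> space M) =
      (\<Prod>k\<in>{i, j}. prob (R k -` {r. x < real r} \<inter> space M))"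
    using assms by (intro indep_varsD[OF indep]) auto
  then show ?thesis
    unfolding eq using assms
    by (simp add: tail_increment power2_eq_square Int_def conj_commute cong: conj_cong)
      (simp add: conj_ac)
qed

text \<open>Markov's inequality for the majorant from \<open>le_truncation_bound\<close>. The
  Laplace transform at \<open>1 / x\<close> gives its mean exactly, and
  \<open>1 - exp (- z) \<le> z\<close> turns that mean into a power of \<open>x\<close>.\<close>

lemma prob_small_increments:
  assumes "0 < \<alpha>" "0 < x" "0 < y"
  shows "prob {\<omega> \<in> space M. y \<le> (\<Sum>i=1..n. 2 * x * (1 - exp (- real (R i \<omega>) / x)))}
    \<le> 2 * real n * x powr (1 - \<alpha> / 2) / y"
proof -
  have int: "integrable M (\<lambda>\<omega>. exp (- real (R i \<omega>) / x))" if "i \<ge> 1" for i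
    using that assms by (intro integrable_const_bound[where B = 1]) auto
  define u where "u \<omega> = (\<Sum>i=1..n. 2 * x * (1 - exp (- real (R i \<omega>) / x)))" for \<omega>
  have "prob {\<omega> \<in> space M. y \<le> u \<omega>} \<le> expectation u / y"
  proof (rule integral_Markov_inequality_measure[where A = "{}"])
    show "integrable M u"
      unfolding u_def[abs_def] using int by auto
    show "AE \<omega> in M. 0 \<le> u \<omega>"
      using assms by (auto simp: u_def intro!: sum_nonneg)
  qed (use assms in auto)
  also have "expectation u = (\<Sum>i=1..n. 2 * x * (1 - expectation (\<lambda>\<omega>. exp (- real (R i \<omega>) / x))))"
    unfolding u_def[abs_def] using int
    by (subst Bochner_Integration.integral_sum) (auto simp: prob_space)
  also have "\<dots> = (\<Sum>i=1..n. 2 * x * (1 - exp (- (1 / x))) powr (\<alpha> / 2))"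
  proof (intro sum.cong refl)
    fix i assume "i \<in> {1..n}"
    then show "2 * x * (1 - expectation (\<lambda>\<omega>. exp (- real (R i \<omega>) / x))) =
        2 * x * (1 - exp (- (1 / x))) powr (\<alpha> / 2)"
      using expectation_exp_increment[of i "1 / x"] assms by simp
  qed
  also have "\<dots> \<le> (\<Sum>i=1..n. 2 * x * (1 / x) powr (\<alpha> / 2))"
    using assms exp_ge_add_one_self[of "- (1 / x)"]
    by (intro sum_mono mult_left_mono powr_mono2) auto
  also have "\<dots> = 2 * real n * x powr (1 - \<alpha> / 2)"
    using assms by (simp add: powr_diff powr_divide)
  finally show ?thesis
    using assms by (simp add: u_def divide_right_mono)
qed

lemma compl_subordinator_cdf_le:
  assumes "0 < \<alpha>" "0 < t" "0 < \<epsilon>" "\<epsilon> < 1" "0 < \<eta>"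
  shows "1 - subordinator_cdf M R n t \<le> real n * tail ((1 - \<epsilon>) * t)
    + (real n * tail (\<eta> * t))\<^sup>2 + 2 * real n * (\<eta> * t) powr (1 - \<alpha> / 2) / (\<epsilon> * t)"
proof -
  define A where "A i = {\<omega> \<in> space M. (1 - \<epsilon>) * t < real (R i \<omega>)}" for i
  define B where "B i j = {\<omega> \<in> space M. \<eta> * t < real (R i \<omega>) \<and> \<eta> * t < real (R j \<omega>)}" for i j
  define I where "I = {p \<in> {1..n} \<times> {1..n}. fst p \<noteq> snd p}"
  define u where "u i \<omega> = 2 * (\<eta> * t) * (1 - exp (- real (R i \<omega>) / (\<eta> * t)))" for i \<omega>
  \<comment> \<open>This contains the event that the increments of size at most
    \<open>\<eta> * t\<close> add up to more than \<open>\<epsilon> * t\<close>, since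
    \<open>u i\<close> dominates these and is nonnegative for the others.\<close>
  define C where "C = {\<omega> \<in> space M. \<epsilon> * t \<le> (\<Sum>i=1..n. u i \<omega>)}"
  have \<eta>t: "\<eta> * t > 0"
    using assms by simp
  have u_nonneg: "0 \<le> u i \<omega>" for i \<omega>
    using \<eta>t by (auto simp: u_def)
  have small: "real (R i \<omega>) \<le> u i \<omega>" if "real (R i \<omega>) \<le> \<eta> * t" for i \<omega>
    unfolding u_def using that \<eta>t by (intro le_truncation_bound) auto
  have cover: "\<omega> \<in> (\<Union>i\<in>{1..n}. A i) \<union> (\<Union>p\<in>I. B (fst p) (snd p)) \<union> C"
    if \<omega>: "\<omega> \<in> space M" and big: "t < real (partial_sum R n \<omega>)" for \<omega>
  proof (rule ccontr)
    assume "\<not> ?thesis"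
    then have noA: "\<And>i. i \<in> {1..n} \<Longrightarrow> real (R i \<omega>) \<le> (1 - \<epsilon>) * t"
      and noB: "\<And>i j. i \<in> {1..n} \<Longrightarrow> j \<in> {1..n} \<Longrightarrow> i \<noteq> j \<Longrightarrow> \<eta> * t < real (R i \<omega>) \<Longrightarrow>
        real (R j \<omega>) \<le> \<eta> * t"
      and noC: "(\<Sum>i=1..n. u i \<omega>) < \<epsilon> * t"
      using \<omega> by (force simp: A_def B_def I_def C_def not_less)+
    have sum_eq: "real (partial_sum R n \<omega>) = (\<Sum>i=1..n. real (R i \<omega>))"
      by (simp add: partial_sum_def)
    show False
    \<comment> \<open>Outside all \<open>B i j\<close> with distinct indices at most one increment
      exceeds \<open>\<eta> * t\<close>. It is at most \<open>(1 - \<epsilon>) * t\<close>, while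
      the others are dominated by the \<open>u i\<close>, whose sum is below
      \<open>\<epsilon> * t\<close>; the total cannot exceed \<open>t\<close>.\<close>
    proof (cases "\<exists>j\<in>{1..n}. \<eta> * t < real (R j \<omega>)")
      case True
      then obtain j where j: "j \<in> {1..n}" "\<eta> * t < real (R j \<omega>)" by auto
      have "(\<Sum>i=1..n. real (R i \<omega>)) = real (R j \<omega>) + (\<Sum>i\<in>{1..n} - {j}. real (R i \<omega>))"
        using j by (intro sum.remove) auto
      also have "\<dots> \<le> (1 - \<epsilon>) * t + (\<Sum>i\<in>{1..n} - {j}. u i \<omega>)"
        using j noB by (intro add_mono sum_mono small noA) auto
      also have "(\<Sum>i\<in>{1..n} - {j}. u i \<omega>) \<le> (\<Sum>i=1..n. u i \<omega>)"
        using u_nonneg by (intro sum_mono2) auto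
      finally show False
        using noC big sum_eq by (simp add: algebra_simps)
    next
      case False
      then have "(\<Sum>i=1..n. real (R i \<omega>)) \<le> (\<Sum>i=1..n. u i \<omega>)"
        by (intro sum_mono small) (auto simp: not_less)
      moreover have "\<epsilon> * t \<le> t"
        using assms by simp
      ultimately show False
        using noC big sum_eq by simp
    qed
  qed
  have [measurable]: "A i \<in> events" if "i \<in> {1..n}" for i
  proof -
    have [measurable]: "R i \<in> measurable M (count_space UNIV)"
      using that by auto
    show ?thesis
      unfolding A_def by measurable
  qed
  have [measurable]: "B i j \<in> events" if "(i, j) \<in> I" for i j
  proof -
    have [measurable]: "R i \<in> measurable M (count_space UNIV)"
      "R j \<in> measurable M (count_space UNIV)"
      using that by (auto simp: I_def)
    show ?thesis
      unfolding B_def by measurable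
  qed
  have [measurable]: "C \<in> events"
    unfolding C_def u_def by measurable
  have fin: "finite I"
    by (simp add: I_def)
  have "1 - subordinator_cdf M R n t \<le>
      prob ((\<Union>i\<in>{1..n}. A i) \<union> (\<Union>p\<in>I. B (fst p) (snd p)) \<union> C)"
    unfolding compl_subordinator_cdf using cover fin
    by (intro finite_measure_mono) (auto intro!: sets.finite_UN)
  also have "\<dots> \<le> prob (\<Union>i\<in>{1..n}. A i) + prob (\<Union>p\<in>I. B (fst p) (snd p)) + prob C"
    using fin by (intro order_trans[OF measure_Un_le] add_right_mono measure_Un_le)
      (auto intro!: sets.finite_UN)
  also have "prob (\<Union>i\<in>{1..n}. A i) \<le> (\<Sum>i\<in>{1..n}. prob (A i))"
    by (intro measure_UNION_le) auto
  also have "\<dots> = real n * tail ((1 - \<epsilon>) * t)"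
    by (simp add: A_def tail_increment)
  also have "prob (\<Union>p\<in>I. B (fst p) (snd p)) \<le> (\<Sum>p\<in>I. prob (B (fst p) (snd p)))"
    using fin by (intro measure_UNION_le) auto
  also have "\<dots> = (\<Sum>p\<in>I. (tail (\<eta> * t))\<^sup>2)"
    by (intro sum.cong refl) (auto simp: B_def I_def prob_two_increments)
  \<comment> \<open>Adding the diagonal makes the bound a perfect square.\<close>
  also have "\<dots> \<le> (\<Sum>p\<in>{1..n} \<times> {1..n}. (tail (\<eta> * t))\<^sup>2)"
    by (intro sum_mono2) (auto simp: I_def)
  also have "\<dots> = (real n * tail (\<eta> * t))\<^sup>2"
    by (simp add: power2_eq_square)
  also have "prob C \<le> 2 * real n * (\<eta> * t) powr (1 - \<alpha> / 2) / (\<epsilon> * t)"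
    unfolding C_def u_def using assms \<eta>t by (intro prob_small_increments) auto
  finally show ?thesis
    by simp
qed

section \<open>Passage to the limit along arbitrary sequences\<close>

lemma compl_subordinator_cdf_asymptotic:
  fixes n :: "nat \<Rightarrow> nat" and t :: "nat \<Rightarrow> real"
  assumes \<alpha>: "0 < \<alpha>" "\<alpha> < 2" and n: "\<And>k. n k \<ge> 1" and t: "\<And>k. t k > 0"
    and lim: "(\<lambda>k. real (n k) * t k powr (- \<alpha> / 2)) \<longlonglongrightarrow> 0"
  shows "(\<lambda>k. (1 - subordinator_cdf M R (n k) (t k)) / (real (n k) * t k powr (- \<alpha> / 2)))
    \<longlonglongrightarrow> 1 / Gamma (1 - \<alpha> / 2)"
proof -
  define \<beta> where "\<beta> = \<alpha> / 2"
  define L where "L = 1 / Gamma (1 - \<beta>)"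
  define u where "u k = real (n k) * t k powr (- \<beta>)" for k
  define q where "q k = (1 - subordinator_cdf M R (n k) (t k)) / u k" for k
  define g where "g x = tail x * x powr \<beta>" for x
  have \<beta>: "0 < \<beta>" "\<beta> < 1"
    using \<alpha> by (auto simp: \<beta>_def)
  have u_lim: "u \<longlonglongrightarrow> 0"
    using lim by (simp add: u_def[abs_def] \<beta>_def)
  have u_pos: "u k > 0" for k
    using n[of k] t[of k] by (auto simp: u_def)
  \<comment> \<open>Since \<open>n k\<close> is at least 1, \<open>u\<close> dominates this power of
    \<open>t\<close>. Hence \<open>t\<close> tends to infinity and the tail asymptotics
    apply.\<close>
  have "(\<lambda>k. t k powr (- \<beta>)) \<longlonglongrightarrow> 0"
  proof (rule tendsto_sandwich[OF _ _ tendsto_const u_lim])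
    show "\<forall>\<^sub>F k in sequentially. t k powr (- \<beta>) \<le> u k"
      using n by (auto simp: u_def mult_le_cancel_right1)
  qed auto
  then have "filterlim (\<lambda>k. inverse (t k powr (- \<beta>))) at_top sequentially"
    using t by (intro filterlim_inverse_at_top) (auto simp: less_imp_neq[symmetric])
  moreover have "filterlim (\<lambda>x::real. x powr (1 / \<beta>)) at_top at_top"
    using \<beta> by real_asymp
  ultimately have "filterlim (\<lambda>k. (t k powr \<beta>) powr (1 / \<beta>)) at_top sequentially"
    by (auto simp: powr_minus dest: filterlim_compose)
  then have t_lim: "filterlim t at_top sequentially"
    using \<beta> t by (simp add: powr_powr less_imp_le)
  have g_lim: "(\<lambda>k. g (c * t k)) \<longlonglongrightarrow> L" if "c > 0" for c
    using tail_asymptotic filterlim_tendsto_pos_mult_at_top[OF tendsto_const that t_lim]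
    unfolding g_def L_def \<beta>_def by (rule filterlim_compose)
  have n_tail: "real (n k) * tail (c * t k) = u k * (g (c * t k) * c powr (- \<beta>))"
    if "c > 0" for c k
    using that t[of k] by (simp add: u_def g_def powr_mult powr_minus field_simps)
  have "q \<longlonglongrightarrow> L"
  proof (rule order_tendstoI)
    fix a assume "a < L"
    \<comment> \<open>The lower bound divided by \<open>u k\<close>: its denominator tends to 1
      because \<open>g\<close> converges and \<open>u\<close> vanishes.\<close>
    have "(\<lambda>k. g (1 * t k) / (1 + u k * g (1 * t k))) \<longlonglongrightarrow> L / (1 + 0 * L)"
      by (intro tendsto_intros g_lim u_lim) auto
    then have "\<forall>\<^sub>F k in sequentially. a < g (1 * t k) / (1 + u k * g (1 * t k))"
      using \<open>a < L\<close> by (intro order_tendstoD) auto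
    then show "\<forall>\<^sub>F k in sequentially. a < q k"
    proof eventually_elim
      case (elim k)
      have "real (n k) * tail (t k) = u k * g (t k)"
        using n_tail[of 1 k] by simp
      then have "u k * g (t k) / (1 + u k * g (t k)) \<le> 1 - subordinator_cdf M R (n k) (t k)"
        using compl_subordinator_cdf_ge[OF n, of k "t k"] by simp
      then have "g (t k) / (1 + u k * g (t k)) \<le> q k"
        using u_pos[of k] by (simp add: q_def le_divide_eq mult.commute)
      with elim show ?case
        by simp
    qed
  next
    fix a assume "L < a"
    \<comment> \<open>First \<open>\<epsilon>\<close> is fixed so that the one-jump term stays below
      \<open>a\<close>. Only then is \<open>\<eta>\<close> chosen, because the term for small
      increments carries the factor \<open>1 / \<epsilon>\<close>.\<close>
    have "((\<lambda>\<epsilon>. L * (1 - \<epsilon>) powr (- \<beta>)) \<longlongrightarrow> L * (1 - 0) powr (- \<beta>)) (at_right 0)"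
      by (intro tendsto_intros) auto
    then have "\<forall>\<^sub>F \<epsilon> in at_right 0. L * (1 - \<epsilon>) powr (- \<beta>) < a"
      using \<open>L < a\<close> by (intro order_tendstoD) auto
    moreover have "\<forall>\<^sub>F \<epsilon> :: real in at_right 0. \<epsilon> \<in> {0<..<1}"
      by (rule eventually_at_right_real) simp
    ultimately obtain \<epsilon> where \<epsilon>: "L * (1 - \<epsilon>) powr (- \<beta>) < a" "0 < \<epsilon>" "\<epsilon> < 1"
      by (metis (no_types, lifting) eventually_conj eventually_happens'
        trivial_limit_at_right_real greaterThanLessThan_iff)
    \<comment> \<open>As \<open>\<beta> < 1\<close>, the exponent is positive and the
      small-increment term tends to 0 with \<open>\<eta>\<close>; its limit is written with
      \<open>0 powr (1 - \<beta>)\<close>, which is 0.\<close>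
    have "((\<lambda>\<eta>. L * (1 - \<epsilon>) powr (- \<beta>) + 2 * \<eta> powr (1 - \<beta>) / \<epsilon>) \<longlongrightarrow>
        L * (1 - \<epsilon>) powr (- \<beta>) + 2 * 0 powr (1 - \<beta>) / \<epsilon>) (at_right 0)"
      using \<beta> \<epsilon> by (intro tendsto_intros) (auto simp: eventually_at_right_less less_imp_le
        intro!: eventually_mono[OF eventually_at_right_less])
    then have "\<forall>\<^sub>F \<eta> in at_right 0. L * (1 - \<epsilon>) powr (- \<beta>) + 2 * \<eta> powr (1 - \<beta>) / \<epsilon> < a"
      using \<epsilon> by (intro order_tendstoD) auto
    then obtain \<eta> where \<eta>: "L * (1 - \<epsilon>) powr (- \<beta>) + 2 * \<eta> powr (1 - \<beta>) / \<epsilon> < a" "0 < \<eta>"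
      using eventually_at_right_less[of "0::real"]
      by (metis (no_types, lifting) eventually_conj eventually_happens' trivial_limit_at_right_real)
    \<comment> \<open>The upper bound divided by \<open>u k\<close>. The two-jump term is quadratic
      in \<open>u k\<close>, so one factor survives the division and makes it vanish.\<close>
    define h where "h k = g ((1 - \<epsilon>) * t k) * (1 - \<epsilon>) powr (- \<beta>)
      + u k * (g (\<eta> * t k) * \<eta> powr (- \<beta>))\<^sup>2 + 2 * \<eta> powr (1 - \<beta>) / \<epsilon>" for k
    have "h \<longlonglongrightarrow> L * (1 - \<epsilon>) powr (- \<beta>) + 0 * (L * \<eta> powr (- \<beta>))\<^sup>2 + 2 * \<eta> powr (1 - \<beta>) / \<epsilon>"
      unfolding h_def[abs_def] using \<epsilon> \<eta> by (intro tendsto_intros g_lim u_lim) auto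
    then have "\<forall>\<^sub>F k in sequentially. h k < a"
      using \<eta> by (intro order_tendstoD) auto
    then show "\<forall>\<^sub>F k in sequentially. q k < a"
    proof eventually_elim
      case (elim k)
      \<comment> \<open>This term has the same order \<open>u k\<close> as the main one, so it is
        made small by \<open>\<eta>\<close> and not by letting \<open>k\<close> grow.\<close>
      have "2 * real (n k) * (\<eta> * t k) powr (1 - \<beta>) / (\<epsilon> * t k) =
          u k * (2 * \<eta> powr (1 - \<beta>) / \<epsilon>)"
        using t[of k] \<epsilon> \<eta> by (simp add: u_def powr_mult powr_diff powr_minus field_simps)
      then have "1 - subordinator_cdf M R (n k) (t k) \<le> u k * h k"
        using compl_subordinator_cdf_le[OF \<alpha>(1) t \<epsilon>(2,3) \<eta>(2), of "n k" k]
          n_tail[of "1 - \<epsilon>" k] n_tail[of \<eta> k] \<epsilon> \<eta>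
        by (simp add: h_def \<beta>_def[symmetric] power2_eq_square algebra_simps)
      then have "q k \<le> h k"
        using u_pos[of k] by (simp add: q_def divide_le_eq mult.commute)
      with elim show ?case
        by simp
    qed
  qed
  then show ?thesis
    by (simp add: q_def[abs_def] u_def L_def \<beta>_def)
qed

end

theorem theorem3:
  fixes M :: "'a measure" and \<alpha> :: real and R :: "nat \<Rightarrow> 'a \<Rightarrow> nat"
    and n :: "nat \<Rightarrow> nat" and t :: "nat \<Rightarrow> real"
  assumes "0 < \<alpha>" and "\<alpha> < 2"
    and "discrete_subordinator M \<alpha> R"
    and "\<And>k. n k \<ge> 1" and "\<And>k. t k > 0"
    and "(\<lambda>k. real (n k) * t k powr (- \<alpha> / 2)) \<longlonglongrightarrow> 0"
  shows "(\<lambda>k. (1 - subordinator_cdf M R (n k) (t k)) /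
              (real (n k) * t k powr (- \<alpha> / 2) / Gamma (1 - \<alpha> / 2))) \<longlonglongrightarrow> 1"
proof -
  have "Gamma (1 - \<alpha> / 2) > 0"
    using assms(2) by (intro Gamma_real_pos) simp
  moreover have "(\<lambda>k. (1 - subordinator_cdf M R (n k) (t k)) / (real (n k) * t k powr (- \<alpha> / 2))
      * Gamma (1 - \<alpha> / 2)) \<longlonglongrightarrow> 1 / Gamma (1 - \<alpha> / 2) * Gamma (1 - \<alpha> / 2)"
    by (intro tendsto_mult tendsto_const
      discrete_subordinator.compl_subordinator_cdf_asymptotic assms)
  ultimately show ?thesis
    by simp
qed

end
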